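(* There exists a $19\times 19$ matrix $H$, each of whose entries is a sixth root of unity (i.e. of the form $e^{2\pi i j/6}$ for some $j\in\{0,1,\dots,5\}$), such that $HH^\ast = 19\, I_{19}$, where $H^\ast$ denotes the conjugate transpose of $H$ and $I_{19}$ is the $19\times 19$ identity matrix. In other words, a Butson-type complex Hadamard matrix $BH(19,6)$ exists.
   Context: A complex Hadamard matrix of order $n$ is an $n\times n$ complex matrix $H$ with unimodular entries satisfying $HH^\ast = nI_n$. A Butson-type complex Hadamard matrix $BH(n,q)$ is a complex Hadamard matrix of order $n$ all of whose entries are $q$th roots of unity. *)

theory Defs
  imports "Jordan_Normal_Form.Schur_Decomposition" "HOL-Analysis.Complex_Transcendental"
begin

definition complex_hadamard :: "nat \<Rightarrow> complex mat \<Rightarrow> bool" where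
  "complex_hadamard n H \<longleftrightarrow>
     H \<in> carrier_mat n n \<and>
     (\<forall>i<n. \<forall>k<n. cmod (H $$ (i, k)) = 1) \<and>
     H * mat_adjoint H = of_nat n \<cdot>\<^sub>m 1\<^sub>m n"

definition roots_of_unity :: "nat \<Rightarrow> complex set" where
  "roots_of_unity q = {exp (2 * of_real pi * \<i> * of_nat j / of_nat q) | j. j < q}"

lemma roots_of_unity_altdef:
  assumes "q > 0"
  shows "roots_of_unity q = {z. z ^ q = 1}"
  using complex_roots_unity[of q] assms by (auto simp: roots_of_unity_def)

definition butson_hadamard :: "nat \<Rightarrow> nat \<Rightarrow> complex mat \<Rightarrow> bool" where
  "butson_hadamard n q H \<longleftrightarrow>
     complex_hadamard n H \<and> (\<forall>i<n. \<forall>k<n. H $$ (i, k) \<in> roots_of_unity q)"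

text \<open>The library defines \<^const>\<open>mat_adjoint\<close> through lists of rows and columns; it is the
  conjugate transpose.\<close>

lemma mat_adjoint_index:
  assumes "i < dim_col A" "k < dim_row A"
  shows "mat_adjoint (A :: complex mat) $$ (i, k) = cnj (A $$ (k, i))"
  using assms by (simp add: mat_adjoint_def mat_of_rows_def)

end

theory Submission
  imports Defs
begin

text \<open>The matrix consists of a border of ones around a two-by-two array of \<open>9 \<times> 9\<close> blocks, each
  of which is determined by its first row: row \<open>i\<close> of a block is the first row rotated by \<open>i\<close>. Inner
  products of rows are computed exactly in \<open>\<int>[\<zeta>]\<close> with \<open>\<zeta> = exp (\<pi>\<i>/3)\<close>, in coordinates with respect
  to the basis \<open>1, \<zeta>\<close>. The four first rows were found by a computer search: the exponent lists of
  length 9 are hashed by their periodic autocorrelations to find all pairs that can form a block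
  row, and the block rows are then compared with each other.\<close>

definition zeta6 :: complex where
  "zeta6 = cis (pi / 3)"

text \<open>\<open>zeta6\<close> is a root of the sixth cyclotomic polynomial; this relation reduces
  its powers to the basis \<open>1, zeta6\<close>.\<close>

lemma zeta6_squared: "zeta6\<^sup>2 = zeta6 - 1"
  by (simp add: zeta6_def complex_eq_iff power2_eq_square cos_60 sin_60)

lemma zeta6_pow_6: "zeta6 ^ 6 = 1"
proof -
  have "zeta6 ^ 6 = cis (6 * (pi / 3))"
    unfolding zeta6_def Complex.DeMoivre by simp
  then show ?thesis
    by simp
qed

text \<open>On the unit circle conjugation is inversion, and a sixth root of unity has its fifth
  power as inverse. Exponents thus stay natural numbers.\<close>

lemma cnj_zeta6: "cnj zeta6 = zeta6 ^ 5"
proof -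
  have *: "zeta6 * cnj zeta6 = 1"
    by (simp add: zeta6_def cis_cnj cis_mult)
  have "cnj zeta6 = zeta6 ^ 6 * cnj zeta6"
    by (simp add: zeta6_pow_6)
  also have "\<dots> = zeta6 ^ 5 * (zeta6 * cnj zeta6)"
    by (simp add: eval_nat_numeral)
  finally show ?thesis
    by (simp add: *)
qed

lemma norm_zeta6: "cmod zeta6 = 1"
  by (simp add: zeta6_def)

lemma zeta6_pow_mod: "zeta6 ^ (n mod 6) = zeta6 ^ n"
proof -
  have "zeta6 ^ n = zeta6 ^ (6 * (n div 6) + n mod 6)"
    by simp
  also have "\<dots> = zeta6 ^ (n mod 6)"
    unfolding power_add power_mult zeta6_pow_6 by simp
  finally show ?thesis ..
qed

definition eis :: "int \<times> int \<Rightarrow> complex" where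
  "eis p = of_int (fst p) + of_int (snd p) * zeta6"

definition zeta6_coords :: "(int \<times> int) list" where
  "zeta6_coords = [(1, 0), (0, 1), (-1, 1), (-1, 0), (0, -1), (1, -1)]"

lemma eis_zeta6_coords: "eis (zeta6_coords ! (n mod 6)) = zeta6 ^ n"
proof -
  have *: "zeta6 * zeta6 = zeta6 - 1"
    using zeta6_squared by (simp add: power2_eq_square)
  have "\<forall>m\<in>{0, 1, 2, 3, 4, 5}. eis (zeta6_coords ! m) = zeta6 ^ m"
    by (simp add: eis_def zeta6_coords_def eval_nat_numeral * algebra_simps)
  moreover have "n mod 6 \<in> {0, 1, 2, 3, 4, 5}"
    using mod_less_divisor[of 6 n] by (auto simp del: mod_less_divisor)
  ultimately show ?thesis
    by (simp only: zeta6_pow_mod)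
qed

text \<open>\<open>a + 5 * b\<close> is the exponent of \<open>zeta6 ^ a * cnj (zeta6 ^ b)\<close>,
  since conjugation multiplies exponents by 5.\<close>

fun row_product :: "nat list \<Rightarrow> nat list \<Rightarrow> int \<times> int" where
  "row_product (a # as) (b # bs) =
     (let p = zeta6_coords ! ((a + 5 * b) mod 6); q = row_product as bs
      in (fst p + fst q, snd p + snd q))"
| "row_product _ _ = (0, 0)"

lemma eis_row_product:
  assumes "length xs = length ys"
  shows "(\<Sum>k<length xs. zeta6 ^ (xs ! k) * cnj (zeta6 ^ (ys ! k))) = eis (row_product xs ys)"
  using assms
proof (induction xs ys rule: list_induct2)
  case Nil
  then show ?case
    by (simp add: eis_def)
next
  case (Cons a as b bs)
  have "zeta6 ^ a * cnj (zeta6 ^ b) = eis (zeta6_coords ! ((a + 5 * b) mod 6))"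
    by (simp add: eis_zeta6_coords cnj_zeta6 power_add power_mult)
  with Cons show ?case
    by (simp add: sum.lessThan_Suc_shift Let_def eis_def algebra_simps del: sum.lessThan_Suc)
qed

text \<open>The leading 0 belongs to the border column. As \<open>rotate\<close> shifts to the left,
  the blocks are back-circulant: an entry depends only on the sum of its indices modulo 9.\<close>

definition block_row :: "nat list \<Rightarrow> nat list \<Rightarrow> nat list list" where
  "block_row xs ys = map (\<lambda>i. 0 # rotate i xs @ rotate i ys) [0..<9]"

text \<open>The zero row is the top border. The two diagonal blocks coincide.\<close>

definition exponents :: "nat list list" where
  "exponents = replicate 19 0
     # block_row [1, 1, 3, 5, 5, 3, 1, 1, 5] [1, 3, 3, 1, 3, 5, 4, 5, 3]
     @ block_row [1, 4, 1, 5, 3, 3, 3, 3, 5] [1, 1, 3, 5, 5, 3, 1, 1, 5]"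

lemma length_exponents: "length exponents = 19"
  by (simp add: exponents_def block_row_def)

lemma length_exponents_nth: "i < 19 \<Longrightarrow> length (exponents ! i) = 19"
  using nth_mem[of i exponents] unfolding length_exponents
  by (auto simp: exponents_def block_row_def)

text \<open>The finite check behind the theorem: all 361 inner products, computed exactly, where
  \<open>(19, 0)\<close> encodes the number 19.\<close>

lemma exponents_row_products:
  "map (\<lambda>xs. map (row_product xs) exponents) exponents =
   map (\<lambda>i. map (\<lambda>k. if i = k then (19, 0) else (0, 0)) [0..<19]) [0..<19]"
  by code_simp

lemma row_product_exponents:
  assumes "i < 19" "k < 19"
  shows "row_product (exponents ! i) (exponents ! k) = (if i = k then (19, 0) else (0, 0))"
  using arg_cong[OF exponents_row_products, of "\<lambda>xs. xs ! i ! k"] assms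
  by (simp add: length_exponents)

definition bh19 :: "complex mat" where
  "bh19 = Matrix.mat 19 19 (\<lambda>(i, k). zeta6 ^ (exponents ! i ! k))"

lemma bh19_mult_adjoint: "bh19 * mat_adjoint bh19 = of_nat 19 \<cdot>\<^sub>m 1\<^sub>m 19"
proof (rule eq_matI)
  fix i k
  assume "i < dim_row (of_nat 19 \<cdot>\<^sub>m 1\<^sub>m 19 :: complex mat)"
    and "k < dim_col (of_nat 19 \<cdot>\<^sub>m 1\<^sub>m 19 :: complex mat)"
  then have i: "i < 19" and k: "k < 19"
    by auto
  have "(bh19 * mat_adjoint bh19) $$ (i, k) = (\<Sum>j<19. bh19 $$ (i, j) * mat_adjoint bh19 $$ (j, k))"
    using i k by (simp add: bh19_def scalar_prod_def lessThan_atLeast0 mat_adjoint_def mat_of_rows_def)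
  also have "\<dots> = (\<Sum>j<19. zeta6 ^ (exponents ! i ! j) * cnj (zeta6 ^ (exponents ! k ! j)))"
    using i k by (intro sum.cong refl) (simp add: mat_adjoint_index bh19_def)
  also have "\<dots> = eis (row_product (exponents ! i) (exponents ! k))"
    using eis_row_product[of "exponents ! i" "exponents ! k"] i k by (simp add: length_exponents_nth)
  also have "\<dots> = (of_nat 19 \<cdot>\<^sub>m 1\<^sub>m 19) $$ (i, k)"
    using i k by (simp add: row_product_exponents eis_def)
  finally show "(bh19 * mat_adjoint bh19) $$ (i, k) = (of_nat 19 \<cdot>\<^sub>m 1\<^sub>m 19) $$ (i, k)" .
qed (simp_all add: bh19_def mat_adjoint_def mat_of_rows_def)

theorem theorem1p1:
  shows "\<exists>H :: complex mat. butson_hadamard 19 6 H"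
proof
  \<comment> \<open>Swapping the exponents turns \<open>(zeta6 ^ n) ^ 6\<close> into
    \<open>(zeta6 ^ 6) ^ n\<close>, which is 1.\<close>
  have "zeta6 ^ n \<in> roots_of_unity 6" for n
    unfolding roots_of_unity_altdef[OF zero_less_numeral] mem_Collect_eq
      power_mult[symmetric] mult.commute[of n] power_mult zeta6_pow_6 by simp
  then show "butson_hadamard 19 6 bh19"
    using bh19_mult_adjoint
    by (simp add: butson_hadamard_def complex_hadamard_def bh19_def norm_power norm_zeta6)
qed

end
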